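(* Let $\sigma\le\pi$ be permutations such that the interval $[\sigma,\pi]$ of the permutation pattern poset is single. Then $$\mu(\sigma,\pi)=(-1)^{|\pi|-|\sigma|}\,\mathrm{NE}(\sigma,\pi).$$
   Context: A permutation of length $n\ge 1$ is written in one-line notation $\pi=\pi_1\cdots\pi_n$, and $|\pi|=n$. An occurrence of $\sigma$ in $\pi$ is a subsequence of $\pi$ (a choice of positions) whose letters are in the same relative order of size as the letters of $\sigma$. The poset $\mathcal{P}$ is the set of all permutations with $\sigma\le\pi$ iff there is an occurrence of $\sigma$ in $\pi$; $[\sigma,\pi]=\{\lambda:\sigma\le\lambda\le\pi\}$ and $[\sigma,\pi)=\{\lambda: \sigma\le\lambda<\pi\}$. $\mu$ is the Möbius function of $\mathcal{P}$: $\mu(a,b)=0$ if $a\not\le b$, $\mu(a,a)=1$, and $\mu(a,b)=-\sum_{a\le z<b}\mu(a,z)$ for $a<b$. An adjacency in a permutation $\pi$ is a maximal sequence (of length $\ge 1$) of letters in consecutive positions that have consecutive values and are increasing or decreasing. The adjacencies partition the positions of $\pi$. The tail of an adjacency of length at least 2 is all but its first letter; an adjacency of length 1 has no tail. An embedding $\eta$ of $\sigma$ in $\pi$ is a sequence of length $|\pi|$ whose nonzero letters are the letters of an occurrence of $\sigma$ in $\pi$, in the same positions as in $\pi$, all other entries being $0$. An embedding $\eta$ is normal if $\eta_i\neq 0$ at every position $i$ of a letter belonging to the tail of an adjacency of $\pi$. $\mathrm{NE}(\sigma,\pi)$ is the number of normal embeddings of $\sigma$ in $\pi$. Two embeddings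 of $\sigma$ in $\pi$ are equivalent if they differ only within adjacencies of $\pi$, i.e. for every adjacency of $\pi$ they have the same number of nonzero entries among the positions of that adjacency. $\widehat{E}^{\sigma,\pi}$ is the set consisting of the rightmost embedding of each equivalence class, i.e. the one whose nonzero entries within each adjacency occupy the last positions of that adjacency. An interval $[\sigma,\pi]$ has a single block if there is a position $i$ such that $\eta_i=0$ for all $\eta\in\widehat{E}^{\sigma,\pi}$. An interval $[\sigma,\pi]$ is single if for all $\lambda\in[\sigma,\pi)$ the interval $[\lambda,\pi]$ has a single block. *)

theory Defs
  imports Main
begin

definition permutation :: "nat list \<Rightarrow> bool" where
  "permutation p \<longleftrightarrow> p \<noteq> [] \<and> distinct p \<and> set p = {1..length p}"

definition order_iso :: "nat list \<Rightarrow> nat list \<Rightarrow> bool" where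
  "order_iso xs ys \<longleftrightarrow> length xs = length ys \<and>
     (\<forall>i<length xs. \<forall>j<length xs. xs ! i < xs ! j \<longleftrightarrow> ys ! i < ys ! j)"

text \<open>An occurrence is given by its set of positions; positions count from 0.\<close>

definition occurrences :: "nat list \<Rightarrow> nat list \<Rightarrow> nat set set" where
  "occurrences s p = {I. I \<subseteq> {..<length p} \<and> order_iso (nths p I) s}"

definition pattern_le :: "nat list \<Rightarrow> nat list \<Rightarrow> bool" where
  "pattern_le s p \<longleftrightarrow> occurrences s p \<noteq> {}"

definition pattern_less :: "nat list \<Rightarrow> nat list \<Rightarrow> bool" where
  "pattern_less s p \<longleftrightarrow> pattern_le s p \<and> s \<noteq> p"

definition pattern_interval :: "nat list \<Rightarrow> nat list \<Rightarrow> nat list set" where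
  "pattern_interval s p = {l. permutation l \<and> pattern_le s l \<and> pattern_le l p}"

definition half_open_interval :: "nat list \<Rightarrow> nat list \<Rightarrow> nat list set" where
  "half_open_interval s p = {l. permutation l \<and> pattern_le s l \<and> pattern_less l p}"

lemma pattern_le_length:
  assumes "pattern_le s p"
  shows "length s \<le> length p"
proof -
  obtain I where "order_iso (nths p I) s"
    using assms by (auto simp: pattern_le_def occurrences_def)
  then have "length s = length (nths p I)" by (simp add: order_iso_def)
  also have "\<dots> = card {i. i < length p \<and> i \<in> I}" by (simp add: length_nths)
  also have "\<dots> \<le> card {..<length p}" by (rule card_mono) auto
  finally show ?thesis by simp
qed

lemma order_iso_permutation_eq:
  assumes "permutation p" "permutation q" "order_iso p q"
  shows "p = q"
proof (rule nth_equalityI)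
  show len: "length p = length q" using assms(3) by (simp add: order_iso_def)
  have rank: "card {j. j < length r \<and> r ! j < r ! i} = r ! i - 1"
    if r: "permutation r" and i: "i < length r" for r i
  proof -
    have d: "distinct r" and s: "set r = {1..length r}"
      using r by (auto simp: permutation_def)
    have ri: "r ! i \<in> {1..length r}" using i s nth_mem by blast
    have "(\<lambda>j. r ! j) ` {j. j < length r \<and> r ! j < r ! i} = {x \<in> set r. x < r ! i}"
      by (auto simp: set_conv_nth)
    also have "\<dots> = {1..<r ! i}" using s ri by auto
    finally have im: "(\<lambda>j. r ! j) ` {j. j < length r \<and> r ! j < r ! i} = {1..<r ! i}" .
    have "inj_on (\<lambda>j. r ! j) {j. j < length r \<and> r ! j < r ! i}"
      using d by (auto simp: inj_on_def nth_eq_iff_index_eq)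
    then show ?thesis using card_image[of "\<lambda>j. r ! j"] im by fastforce
  qed
  fix i assume i: "i < length p"
  have "{j. j < length p \<and> p ! j < p ! i} = {j. j < length q \<and> q ! j < q ! i}"
    using assms(3) i by (auto simp: order_iso_def)
  then have "p ! i - 1 = q ! i - 1"
    using rank[OF assms(1) i] rank[OF assms(2)] i len by simp
  moreover have "p ! i \<ge> 1" "q ! i \<ge> 1"
    using assms(1,2) i len nth_mem[of i p] nth_mem[of i q]
    by (auto simp: permutation_def simp del: nth_mem)
  ultimately show "p ! i = q ! i" by simp
qed

lemma pattern_less_length:
  assumes "permutation s" "permutation p" "pattern_less s p"
  shows "length s < length p"
proof (rule ccontr)
  assume "\<not> length s < length p"
  with pattern_le_length[of s p] assms(3) have len: "length s = length p"
    by (simp add: pattern_less_def)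
  obtain I where I: "I \<subseteq> {..<length p}" "order_iso (nths p I) s"
    using assms(3) by (auto simp: pattern_less_def pattern_le_def occurrences_def)
  have "card I = length p"
    using I len by (simp add: order_iso_def length_nths)
      (metis (no_types, lifting) Collect_cong Collect_mem_eq lessThan_iff subsetD)
  then have "I = {..<length p}"
    using I(1) by (intro card_subset_eq) auto
  then have "nths p I = p" by (simp add: nths_all)
  then have "p = s" using I(2) assms order_iso_permutation_eq by simp
  then show False using assms(3) by (simp add: pattern_less_def)
qed

lemma finite_pattern_interval: "finite (pattern_interval s p)"
proof (rule finite_subset)
  show "pattern_interval s p \<subseteq> {xs. set xs \<subseteq> {1..length p} \<and> length xs \<le> length p}"
    by (auto simp: pattern_interval_def permutation_def dest!: pattern_le_length)
  show "finite {xs. set xs \<subseteq> {1..length p} \<and> length xs \<le> length p}"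
    by (rule finite_lists_length_le) simp
qed

lemma finite_half_open_interval: "finite (half_open_interval s p)"
  by (rule finite_subset[OF _ finite_pattern_interval[of s p]])
    (auto simp: half_open_interval_def pattern_interval_def pattern_less_def)

text \<open>The function is also set to 0 outside the poset, that is, if one of the lists
  is not a permutation.\<close>

function mobius :: "nat list \<Rightarrow> nat list \<Rightarrow> int" where
  "mobius a b =
     (if \<not> (permutation a \<and> permutation b \<and> pattern_le a b) then 0
      else if a = b then 1
      else - (\<Sum>z\<in>half_open_interval a b. mobius a z))"
  by auto
termination
  by (relation "measure (\<lambda>(a, b). length b)")
    (auto simp: half_open_interval_def intro: pattern_less_length)

declare mobius.simps [simp del]

definition consecutive_run :: "nat list \<Rightarrow> nat set \<Rightarrow> bool" where
  "consecutive_run p A \<longleftrightarrow> (\<exists>i j. i \<le> j \<and> j < length p \<and> A = {i..j} \<and>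
     ((\<forall>k\<in>{i..<j}. p ! Suc k = Suc (p ! k)) \<or>
      (\<forall>k\<in>{i..<j}. p ! k = Suc (p ! Suc k))))"

text \<open>An adjacency is represented by the set of its positions.\<close>

definition adjacencies :: "nat list \<Rightarrow> nat set set" where
  "adjacencies p =
     {A. consecutive_run p A \<and> (\<forall>B. consecutive_run p B \<and> A \<subseteq> B \<longrightarrow> B = A)}"

definition adjacency_tail :: "nat set \<Rightarrow> nat set" where
  "adjacency_tail A = A - {Min A}"

text \<open>The letters of a permutation are positive, so 0 marks exactly the unused positions.\<close>

definition embeddings :: "nat list \<Rightarrow> nat list \<Rightarrow> nat list set" where
  "embeddings s p = {e. length e = length p \<and>
     (\<exists>I\<in>occurrences s p. \<forall>i<length p. e ! i = (if i \<in> I then p ! i else 0))}"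

definition normal_embedding :: "nat list \<Rightarrow> nat list \<Rightarrow> bool" where
  "normal_embedding p e \<longleftrightarrow> (\<forall>A\<in>adjacencies p. \<forall>i\<in>adjacency_tail A. e ! i \<noteq> 0)"

definition NE :: "nat list \<Rightarrow> nat list \<Rightarrow> nat" where
  "NE s p = card {e \<in> embeddings s p. normal_embedding p e}"

definition embedding_equiv :: "nat list \<Rightarrow> nat list \<Rightarrow> (nat list \<times> nat list) set" where
  "embedding_equiv s p = {(e, f). e \<in> embeddings s p \<and> f \<in> embeddings s p \<and>
     (\<forall>A\<in>adjacencies p. card {i \<in> A. e ! i \<noteq> 0} = card {i \<in> A. f ! i \<noteq> 0})}"

definition rightmost :: "nat list \<Rightarrow> nat list \<Rightarrow> bool" where
  "rightmost p e \<longleftrightarrow>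
     (\<forall>A\<in>adjacencies p. \<forall>i\<in>A. \<forall>j\<in>A. i < j \<and> e ! i \<noteq> 0 \<longrightarrow> e ! j \<noteq> 0)"

definition rightmost_embeddings :: "nat list \<Rightarrow> nat list \<Rightarrow> nat list set" where
  "rightmost_embeddings s p =
     {e. \<exists>C \<in> embeddings s p // embedding_equiv s p. e \<in> C \<and> rightmost p e}"

definition single_block :: "nat list \<Rightarrow> nat list \<Rightarrow> bool" where
  "single_block s p \<longleftrightarrow> (\<exists>i<length p. \<forall>e\<in>rightmost_embeddings s p. e ! i = 0)"

definition single_interval :: "nat list \<Rightarrow> nat list \<Rightarrow> bool" where
  "single_interval s p \<longleftrightarrow> (\<forall>l\<in>half_open_interval s p. single_block l p)"

end

theory Submission
  imports Defs
begin

text \<open>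
  Choosing a normal embedding of some \<open>\<lambda> \<in> [\<tau>, \<pi>]\<close> in \<open>\<pi>\<close> amounts to choosing a set \<open>I\<close> of
  positions that contains all tails and an occurrence of \<open>\<tau>\<close>. Pushing the occurrence to the right
  within the adjacencies keeps it inside \<open>I\<close>, so it may be taken rightmost. If \<open>[\<tau>, \<pi>]\<close> has a
  single block, the leftmost position \<open>h\<close> that no rightmost embedding uses is outside every tail,
  and adding or removing \<open>h\<close> is a sign-reversing involution on these sets \<open>I\<close>. Hence
  \<open>f \<lambda> = (-1)^(|\<pi>| - |\<lambda>|) NE(\<lambda>, \<pi>)\<close> satisfies \<open>\<Sum>\<lambda>\<in>[\<tau>, \<pi>]. f \<lambda> = 0\<close> for all
  \<open>\<tau> \<in> [\<sigma>, \<pi>)\<close>, and this sum is 1 for \<open>\<tau> = \<pi>\<close>; Moebius inversion gives \<open>f \<sigma> = \<mu>(\<sigma>, \<pi>)\<close>.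
\<close>

section \<open>Order isomorphism and standardization\<close>

lemma order_iso_refl: "order_iso xs xs"
  by (simp add: order_iso_def)

lemma order_iso_sym: "order_iso xs ys \<Longrightarrow> order_iso ys xs"
  by (auto simp: order_iso_def)

lemma order_iso_trans: "order_iso xs ys \<Longrightarrow> order_iso ys zs \<Longrightarrow> order_iso xs zs"
  by (auto simp: order_iso_def)

lemma nths_zip:
  assumes "length xs = length ys"
  shows "nths (zip xs ys) I = zip (nths xs I) (nths ys I)"
  using assms by (induction xs ys arbitrary: I rule: list_induct2) (auto simp: nths_Cons)

lemma length_nths_cong: "length xs = length ys \<Longrightarrow> length (nths xs I) = length (nths ys I)"
  by (simp add: length_nths)

text \<open>Quantifying over pairs of letters in the same position, not over indices, makes order
  isomorphism pass to sublists: restricting both lists to \<open>I\<close> only shrinks the set of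
  pairs.\<close>

lemma order_iso_iff_zip:
  "order_iso xs ys \<longleftrightarrow> length xs = length ys \<and>
     (\<forall>u\<in>set (zip xs ys). \<forall>v\<in>set (zip xs ys). fst u < fst v \<longleftrightarrow> snd u < snd v)"
  unfolding order_iso_def set_zip by fastforce

lemma order_iso_nths:
  assumes "order_iso xs ys"
  shows "order_iso (nths xs I) (nths ys I)"
  using assms length_nths_cong[of xs ys I]
  unfolding order_iso_iff_zip by (metis in_set_nthsD nths_zip)

lemma order_iso_map:
  assumes "\<And>x y. x \<in> set xs \<Longrightarrow> y \<in> set xs \<Longrightarrow> f x < f y \<longleftrightarrow> x < y"
  shows "order_iso (map f xs) xs"
  using assms by (simp add: order_iso_def)

text \<open>Standardization: each letter is replaced by its rank. This assigns to a nonempty set of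
  positions the pattern that occurs there.\<close>

lemma order_iso_permutation_exists:
  assumes "distinct xs" "xs \<noteq> []"
  obtains q where "permutation q" "order_iso xs q"
proof -
  \<comment> \<open>The count includes \<open>x\<close> itself, so that ranks start at 1, as the
    letters of a permutation do.\<close>
  define r where "r x = card {y \<in> set xs. y \<le> x}" for x
  have less: "r x < r y" if "x < y" "y \<in> set xs" for x y
  proof -
    have "{z \<in> set xs. z \<le> x} \<subseteq> {z \<in> set xs. z \<le> y}" using that(1) by auto
    moreover have "y \<in> {z \<in> set xs. z \<le> y} - {z \<in> set xs. z \<le> x}" using that by simp
    ultimately have "{z \<in> set xs. z \<le> x} \<subset> {z \<in> set xs. z \<le> y}" by blast
    then show ?thesis unfolding r_def by (intro psubset_card_mono) simp_all
  qed
  have mono: "r x < r y \<longleftrightarrow> x < y" if "x \<in> set xs" "y \<in> set xs" for x y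
    using less[of x y] less[of y x] that by (cases x y rule: linorder_cases) auto
  have inj: "inj_on r (set xs)"
  proof (rule inj_onI)
    fix x y assume "x \<in> set xs" "y \<in> set xs" "r x = r y"
    then show "x = y" using less[of x y] less[of y x] by (cases x y rule: linorder_cases) auto
  qed
  have "r ` set xs \<subseteq> {1..length xs}"
  proof
    fix v assume "v \<in> r ` set xs"
    then obtain x where x: "x \<in> set xs" "v = r x" by blast
    have "card {x} \<le> r x" unfolding r_def using x by (intro card_mono) auto
    moreover have "r x \<le> card (set xs)" unfolding r_def by (intro card_mono) auto
    ultimately show "v \<in> {1..length xs}" using x card_length[of xs] by auto
  qed
  moreover have "card (r ` set xs) = card {1..length xs}"
    using inj assms by (simp add: card_image distinct_card)
  ultimately have "r ` set xs = {1..length xs}" by (intro card_subset_eq) auto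
  then have "permutation (map r xs)"
    using inj assms by (simp add: permutation_def distinct_map)
  moreover have "order_iso xs (map r xs)"
    using order_iso_map[of xs r] mono by (blast intro: order_iso_sym)
  ultimately show thesis using that by blast
qed

section \<open>Occurrences and the pattern order\<close>

lemma finite_occurrences: "finite (occurrences s p)"
  by (rule finite_subset[of _ "Pow {..<length p}"]) (auto simp: occurrences_def)

lemma occurrences_subset: "I \<in> occurrences s p \<Longrightarrow> I \<subseteq> {..<length p}"
  by (simp add: occurrences_def)

lemma card_occurrence:
  assumes "I \<in> occurrences s p"
  shows "card I = length s"
proof -
  have "{i. i < length p \<and> i \<in> I} = I" using occurrences_subset[OF assms] by auto
  then show ?thesis
    using assms by (simp add: occurrences_def order_iso_def length_nths)
qed

lemma pattern_le_refl: "pattern_le p p"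
proof -
  have "{..<length p} \<in> occurrences p p"
    by (simp add: occurrences_def order_iso_refl)
  then show ?thesis by (auto simp: pattern_le_def)
qed

text \<open>The occurrence \<open>I\<close> identifies \<open>b\<close> with the sublist of
  \<open>c\<close> at \<open>I\<close>, so finding \<open>a\<close> in \<open>b\<close> is finding
  \<open>a\<close> in \<open>c\<close> within \<open>I\<close>. This turns the pattern order below
  \<open>c\<close> into inclusion of position sets.\<close>

lemma pattern_le_iff_occurrence_subset:
  assumes I: "I \<in> occurrences b c"
  shows "pattern_le a b \<longleftrightarrow> (\<exists>K\<in>occurrences a c. K \<subseteq> I)"
proof
  have iso: "order_iso (nths c I) b" and sub: "I \<subseteq> {..<length c}"
    using I by (auto simp: occurrences_def)
  assume "pattern_le a b"
  then obtain J where "order_iso (nths b J) a"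
    by (auto simp: pattern_le_def occurrences_def)
  then have iso': "order_iso (nths (nths c I) J) a"
    using order_iso_nths[OF iso] order_iso_trans by blast
  \<comment> \<open>Position \<open>j\<close> of the sublist is the element of \<open>I\<close> with
    exactly \<open>j\<close> smaller elements in \<open>I\<close>. Thus \<open>K\<close> is
    \<open>J\<close> carried back to positions of \<open>c\<close>, in the form in which
    \<open>nths_nths\<close> gives it.\<close>
  define K where "K = {i \<in> I. \<exists>j\<in>J. card {i' \<in> I. i' < i} = j}"
  have "K \<subseteq> I" by (auto simp: K_def)
  moreover have "K \<in> occurrences a c"
    using iso' sub \<open>K \<subseteq> I\<close> unfolding nths_nths K_def[symmetric] occurrences_def by blast
  ultimately show "\<exists>K\<in>occurrences a c. K \<subseteq> I" by blast
next
  have iso: "order_iso (nths c I) b" and sub: "I \<subseteq> {..<length c}"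
    using I by (auto simp: occurrences_def)
  have fin: "finite I" using sub finite_subset by blast
  assume "\<exists>K\<in>occurrences a c. K \<subseteq> I"
  then obtain K where K: "K \<subseteq> I" "order_iso (nths c K) a"
    by (auto simp: occurrences_def)
  \<comment> \<open>The opposite translation: \<open>rk\<close> sends a position of \<open>c\<close>
    in \<open>I\<close> to the corresponding position of \<open>b\<close>.\<close>
  define rk where "rk i = card {i' \<in> I. i' < i}" for i
  have rk_less: "rk i < rk j" if "i < j" "i \<in> I" for i j
  proof -
    have "{i' \<in> I. i' < i} \<subseteq> {i' \<in> I. i' < j}" using that(1) by auto
    moreover have "i \<in> {i' \<in> I. i' < j} - {i' \<in> I. i' < i}" using that by simp
    ultimately have "{i' \<in> I. i' < i} \<subset> {i' \<in> I. i' < j}" by blast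
    then show ?thesis unfolding rk_def using fin by (intro psubset_card_mono) simp_all
  qed
  have "inj_on rk I"
  proof (rule inj_onI)
    fix i j assume "i \<in> I" "j \<in> I" "rk i = rk j"
    then show "i = j" using rk_less[of i j] rk_less[of j i] by (cases i j rule: linorder_cases) auto
  qed
  \<comment> \<open>By injectivity, pulling the image of \<open>K\<close> back along
    \<open>rk\<close> adds no further positions, so the iterated sublist is the sublist at
    \<open>K\<close>.\<close>
  then have "{i \<in> I. \<exists>j\<in>rk ` K. rk i = j} = K"
    using K(1) by (auto simp: inj_on_def)
  then have "nths (nths c I) (rk ` K) = nths c K"
    unfolding nths_nths rk_def by simp
  then have "order_iso (nths b (rk ` K)) a"
    using order_iso_trans[OF order_iso_sym[OF order_iso_nths[OF iso, of "rk ` K"]]] K(2) by simp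
  moreover have "rk i < length b" if "i \<in> I" for i
  proof -
    have "{i' \<in> I. i' < i} \<subset> I" using that by blast
    then show ?thesis
      unfolding rk_def card_occurrence[OF I, symmetric] using fin by (rule psubset_card_mono[rotated])
  qed
  ultimately have "rk ` K \<in> occurrences a b"
    using K(1) by (auto simp: occurrences_def)
  then show "pattern_le a b" by (auto simp: pattern_le_def)
qed

lemma pattern_le_trans: "pattern_le a b \<Longrightarrow> pattern_le b c \<Longrightarrow> pattern_le a c"
  using pattern_le_iff_occurrence_subset unfolding pattern_le_def by blast

lemma pattern_le_antisym:
  assumes "permutation a" "permutation b" "pattern_le a b" "pattern_le b a"
  shows "a = b"
  using pattern_less_length[of a b] pattern_le_length[of b a] assms
  by (force simp: pattern_less_def)

lemma pattern_interval_self: "permutation p \<Longrightarrow> pattern_interval p p = {p}"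
  using pattern_le_antisym by (auto simp: pattern_interval_def pattern_le_refl)

section \<open>Moebius inversion\<close>

lemma sum_mobius_interval:
  assumes "permutation a" "permutation b" "pattern_le a b"
  shows "(\<Sum>z\<in>pattern_interval a b. mobius a z) = (if a = b then 1 else 0)"
proof (cases "a = b")
  case True
  then show ?thesis
    using assms by (simp add: pattern_interval_self mobius.simps[of b b] pattern_le_refl)
next
  case False
  have "pattern_interval a b = insert b (half_open_interval a b)"
    using assms pattern_le_refl
    by (auto simp: pattern_interval_def half_open_interval_def pattern_less_def)
  moreover have "b \<notin> half_open_interval a b"
    by (simp add: half_open_interval_def pattern_less_def)
  ultimately show ?thesis
    using False assms mobius.simps[of a b] by (simp add: finite_half_open_interval)
qed

text \<open>The sum of \<open>mobius s t * f l\<close> over all pairs \<open>t\<close> below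
  \<open>l\<close> in the interval is evaluated in two orders. Summing over \<open>l\<close> first
  leaves \<open>mobius s p\<close> by the hypothesis on \<open>f\<close>; summing over
  \<open>t\<close> first leaves \<open>f s\<close> by \<open>sum_mobius_interval\<close>.\<close>

lemma mobius_eqI:
  fixes f :: "nat list \<Rightarrow> int"
  assumes perm: "permutation s" "permutation p" and le: "pattern_le s p"
    and f: "\<And>t. t \<in> pattern_interval s p \<Longrightarrow>
      (\<Sum>l\<in>pattern_interval t p. f l) = (if t = p then 1 else 0)"
  shows "mobius s p = f s"
proof -
  define P where "P = pattern_interval s p"
  have fin: "finite P" by (simp add: P_def finite_pattern_interval)
  have sP: "s \<in> P" and pP: "p \<in> P"
    using perm le by (simp_all add: P_def pattern_interval_def pattern_le_refl)
  have up: "{l \<in> P. pattern_le t l} = pattern_interval t p" if "t \<in> P" for t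
    using that pattern_le_trans by (auto simp: P_def pattern_interval_def)
  have down: "{t \<in> P. pattern_le t l} = pattern_interval s l" if "l \<in> P" for l
    using that pattern_le_trans by (auto simp: P_def pattern_interval_def)
  have "mobius s p = (\<Sum>t\<in>P. mobius s t * (if t = p then 1 else 0))"
    using fin pP by (simp add: if_distrib[of "(*) _"] cong: if_cong)
  also have "\<dots> = (\<Sum>t\<in>P. \<Sum>l\<in>{l \<in> P. pattern_le t l}. mobius s t * f l)"
    using f up by (intro sum.cong) (auto simp: P_def simp flip: sum_distrib_left)
  also have "\<dots> = (\<Sum>l\<in>P. \<Sum>t\<in>{t \<in> P. pattern_le t l}. mobius s t * f l)"
    by (rule sum.swap_restrict) (use fin in auto)
  also have "\<dots> = (\<Sum>l\<in>P. if s = l then f l else 0)"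
  proof (intro sum.cong refl)
    fix l assume l: "l \<in> P"
    then have "permutation l" "pattern_le s l" by (auto simp: P_def pattern_interval_def)
    then show "(\<Sum>t\<in>{t \<in> P. pattern_le t l}. mobius s t * f l) = (if s = l then f l else 0)"
      using sum_mobius_interval[OF perm(1)] down[OF l] by (simp flip: sum_distrib_right)
  qed
  also have "\<dots> = f s" using fin sP by simp
  finally show ?thesis .
qed

section \<open>Adjacencies described by bonds\<close>

text \<open>The pairs of neighbouring positions in a common adjacency, named by their left member.
  The successors of bonds are exactly the tail positions, which gives a local description of tails
  free of maximality.\<close>

definition bonds :: "nat list \<Rightarrow> nat set" where
  "bonds p = {k. Suc k < length p \<and> (p ! Suc k = Suc (p ! k) \<or> p ! k = Suc (p ! Suc k))}"

text \<open>A bond is a run of two positions, and as there are only finitely many runs it extends to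
  a maximal one.\<close>

lemma bond_in_adjacency:
  assumes "k \<in> bonds p"
  obtains A where "A \<in> adjacencies p" "k \<in> A" "Suc k \<in> A"
proof -
  have "consecutive_run p {k..Suc k}"
    unfolding consecutive_run_def using assms
    by (intro exI[of _ k] exI[of _ "Suc k"]) (auto simp: bonds_def)
  moreover have "finite {A. consecutive_run p A}"
    by (rule finite_subset[of _ "Pow {..<length p}"]) (auto simp: consecutive_run_def)
  ultimately obtain A where A: "consecutive_run p A" "{k..Suc k} \<subseteq> A"
    "\<And>B. consecutive_run p B \<Longrightarrow> A \<subseteq> B \<Longrightarrow> A = B"
    using finite_has_maximal2[of "{A. consecutive_run p A}" "{k..Suc k}"] by auto
  then have "A \<in> adjacencies p" unfolding adjacencies_def by blast
  moreover have "k \<in> A" "Suc k \<in> A" using A(2) by auto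
  ultimately show thesis by (rule that)
qed

lemma adjacency_interval:
  assumes "A \<in> adjacencies p"
  obtains i j where "i \<le> j" "A = {i..j}" "{i..<j} \<subseteq> bonds p"
proof -
  obtain i j where ij: "i \<le> j" "j < length p" "A = {i..j}"
    and run: "(\<forall>k\<in>{i..<j}. p ! Suc k = Suc (p ! k)) \<or> (\<forall>k\<in>{i..<j}. p ! k = Suc (p ! Suc k))"
    using assms by (auto simp: adjacencies_def consecutive_run_def)
  have "{i..<j} \<subseteq> bonds p" using ij(2) run by (auto simp: bonds_def)
  then show thesis using that ij by blast
qed

lemma normal_embedding_iff_bonds:
  "normal_embedding p e \<longleftrightarrow> (\<forall>k\<in>bonds p. e ! Suc k \<noteq> 0)"
proof
  assume normal: "normal_embedding p e"
  show "\<forall>k\<in>bonds p. e ! Suc k \<noteq> 0"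
  proof
    fix k assume "k \<in> bonds p"
    then obtain A where A: "A \<in> adjacencies p" "k \<in> A" "Suc k \<in> A" by (rule bond_in_adjacency)
    then have "finite A" by (metis adjacency_interval finite_atLeastAtMost)
    then have "Min A \<le> k" using A by simp
    then show "e ! Suc k \<noteq> 0"
      using normal A by (auto simp: normal_embedding_def adjacency_tail_def)
  qed
next
  assume bonds: "\<forall>k\<in>bonds p. e ! Suc k \<noteq> 0"
  have "e ! m \<noteq> 0" if A: "A \<in> adjacencies p" and m: "m \<in> adjacency_tail A" for A m
  proof -
    obtain i j where ij: "i \<le> j" "A = {i..j}" "{i..<j} \<subseteq> bonds p"
      using A by (rule adjacency_interval)
    have "Min A = i" using ij by (auto intro: Min_eqI)
    then have "i < m" "m \<le> j" using m ij by (auto simp: adjacency_tail_def)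
    \<comment> \<open>A tail position is not the first of its adjacency, so its left neighbour is a
      bond.\<close>
    then have "m - 1 \<in> {i..<j}" "Suc (m - 1) = m" by auto
    then have "m - 1 \<in> bonds p" "Suc (m - 1) = m" using ij(3) by blast+
    then show ?thesis using bonds by metis
  qed
  then show "normal_embedding p e" by (auto simp: normal_embedding_def)
qed

text \<open>An adjacency is an interval linked by bonds, so being nonzero propagates through it to
  the right one step at a time.\<close>

lemma rightmostI_bonds:
  assumes "\<And>k. k \<in> bonds p \<Longrightarrow> e ! k \<noteq> 0 \<Longrightarrow> e ! Suc k \<noteq> 0"
  shows "rightmost p e"
  unfolding rightmost_def
proof (intro ballI impI)
  fix A m m' assume A: "A \<in> adjacencies p" "m \<in> A" "m' \<in> A" "m < m' \<and> e ! m \<noteq> 0"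
  then obtain i j where ij: "A = {i..j}" "{i..<j} \<subseteq> bonds p"
    by (metis adjacency_interval)
  from A have "m \<le> m'" by simp
  then show "e ! m' \<noteq> 0"
    using A(3)
  proof (induction m' rule: dec_induct)
    case base
    then show ?case using A by simp
  next
    case (step n)
    then have "n \<in> {i..<j}" using A(2) ij(1) by auto
    then show ?case using step assms[of n] ij by force
  qed
qed

lemma rightmost_bond:
  assumes "rightmost p e" "k \<in> bonds p" "e ! k \<noteq> 0"
  shows "e ! Suc k \<noteq> 0"
proof -
  obtain A where "A \<in> adjacencies p" "k \<in> A" "Suc k \<in> A"
    using assms(2) by (rule bond_in_adjacency)
  then show ?thesis using assms(1,3) unfolding rightmost_def by (metis lessI)
qed

text \<open>Each embedding lies in its own class by reflexivity, and classes contain only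
  embeddings, so the classes together make up all embeddings.\<close>

lemma rightmost_embeddings_eq:
  "rightmost_embeddings s p = {e \<in> embeddings s p. rightmost p e}"
  by (auto simp: rightmost_embeddings_def quotient_def embedding_equiv_def)

section \<open>Embeddings as position sets\<close>

definition embedding_of :: "nat list \<Rightarrow> nat set \<Rightarrow> nat list" where
  "embedding_of p I = map (\<lambda>i. if i \<in> I then p ! i else 0) [0..<length p]"

lemma embeddings_eq_image: "embeddings s p = embedding_of p ` occurrences s p"
proof -
  have "e = embedding_of p I \<longleftrightarrow>
      length e = length p \<and> (\<forall>i<length p. e ! i = (if i \<in> I then p ! i else 0))" for e I
  proof -
    have "length (embedding_of p I) = length p"
      "\<And>i. i < length p \<Longrightarrow> embedding_of p I ! i = (if i \<in> I then p ! i else 0)"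
      by (simp_all add: embedding_of_def)
    then show ?thesis by (metis nth_equalityI)
  qed
  then show ?thesis by (simp add: embeddings_def set_eq_iff image_iff)
qed

lemma embedding_of_nth_neq_0:
  assumes "permutation p" "i < length p"
  shows "embedding_of p I ! i \<noteq> 0 \<longleftrightarrow> i \<in> I"
  using assms nth_mem[of i p] by (auto simp: embedding_of_def permutation_def simp del: nth_mem)

text \<open>The nonzero positions of an embedding recover the occurrence it comes from, so
  embeddings can be counted as position sets. Normality then says that the set contains every
  tail.\<close>

lemma NE_eq_card_occurrences:
  assumes "permutation p"
  shows "NE s p = card {I \<in> occurrences s p. Suc ` bonds p \<subseteq> I}"
proof -
  have normal: "normal_embedding p (embedding_of p I) \<longleftrightarrow> Suc ` bonds p \<subseteq> I" for I
    unfolding normal_embedding_iff_bonds using embedding_of_nth_neq_0[OF assms]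
    by (auto simp: bonds_def)
  have "inj_on (embedding_of p) (occurrences s p)"
  proof (rule inj_onI)
    fix I J assume "I \<in> occurrences s p" "J \<in> occurrences s p" "embedding_of p I = embedding_of p J"
    then show "I = J"
      using embedding_of_nth_neq_0[OF assms] occurrences_subset
      by (metis lessThan_iff subsetI subset_antisym subset_iff)
  qed
  then have "inj_on (embedding_of p) {I \<in> occurrences s p. Suc ` bonds p \<subseteq> I}"
    by (rule inj_on_subset) auto
  moreover have "{e \<in> embeddings s p. normal_embedding p e} =
      embedding_of p ` {I \<in> occurrences s p. Suc ` bonds p \<subseteq> I}"
    using normal by (auto simp: embeddings_eq_image)
  ultimately show ?thesis by (simp add: NE_def card_image)
qed

section \<open>Rightmost occurrences and a free position\<close>

text \<open>No chosen position lies between \<open>k\<close> and its free right neighbour, so the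
  move changes one letter and keeps its place in the sublist. As letters are distinct, the change
  can be written as a substitution of values.\<close>

lemma nths_move_right:
  assumes "Suc k < length p" "k \<in> E" "Suc k \<notin> E" "distinct p"
  shows "nths p (insert (Suc k) (E - {k})) = map (\<lambda>x. if x = p ! k then p ! Suc k else x) (nths p E)"
  using assms
proof (induction p arbitrary: k E)
  case Nil
  then show ?case by simp
next
  case (Cons x p)
  show ?case
  proof (cases k)
    case 0
    then obtain y ys where p: "p = y # ys" using Cons.prems(1) by (cases p) auto
    \<comment> \<open>By distinctness \<open>x\<close> does not recur in \<open>ys\<close>, so the
      substitution leaves everything after the first two letters alone.\<close>
    then have "map (\<lambda>z. if z = x then (x # y # ys) ! Suc 0 else z) (nths ys I) = nths ys I" for I
      using Cons.prems(4) by (intro map_idI) (auto dest: in_set_nthsD)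
    then show ?thesis
      using Cons.prems(2,3) unfolding 0 p by (simp add: nths_Cons)
  next
    case (Suc k')
    have "{j. Suc j \<in> insert (Suc k) (E - {k})} = insert (Suc k') ({j. Suc j \<in> E} - {k'})"
      using Suc by auto
    moreover have "x \<noteq> p ! k'" using Cons.prems(1,4) Suc by auto
    ultimately show ?thesis
      using Cons.IH[of k' "{j. Suc j \<in> E}"] Cons.prems Suc by (auto simp: nths_Cons)
  qed
qed

text \<open>The letters at the two ends of a bond have consecutive values, so every other letter
  compares with both in the same way. Since the right one is not in use, exchanging them preserves
  the pattern.\<close>

lemma occurrence_move_right:
  assumes E: "E \<in> occurrences s p" and p: "distinct p"
    and k: "k \<in> bonds p" "k \<in> E" "Suc k \<notin> E"
  shows "insert (Suc k) (E - {k}) \<in> occurrences s p"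
proof -
  define f where "f x = (if x = p ! k then p ! Suc k else x)" for x
  have kl: "Suc k < length p" and step: "p ! Suc k = Suc (p ! k) \<or> p ! k = Suc (p ! Suc k)"
    using k(1) by (auto simp: bonds_def)
  have "p ! Suc k \<notin> set (nths p E)"
    using p k(3) kl by (auto simp: set_nths nth_eq_iff_index_eq)
  then have "f x < f y \<longleftrightarrow> x < y" if "x \<in> set (nths p E)" "y \<in> set (nths p E)" for x y
  proof -
    have "x \<noteq> p ! Suc k" "y \<noteq> p ! Suc k"
      using that \<open>p ! Suc k \<notin> set (nths p E)\<close> by metis+
    then show ?thesis using step unfolding f_def by auto
  qed
  then have "order_iso (map f (nths p E)) (nths p E)" by (rule order_iso_map)
  moreover have "map f (nths p E) = nths p (insert (Suc k) (E - {k}))"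
    unfolding f_def using nths_move_right[OF kl k(2,3) p] by simp
  ultimately show ?thesis
    using E kl order_iso_trans by (auto simp: occurrences_def)
qed

text \<open>Among the occurrences inside \<open>I\<close>, one with maximal sum of positions is rightmost.\<close>

lemma rightmost_occurrence_exists:
  assumes p: "permutation p" and E: "E \<in> occurrences s p" "E \<subseteq> I" and I: "Suc ` bonds p \<subseteq> I"
  obtains E' where "E' \<in> occurrences s p" "E' \<subseteq> I" "rightmost p (embedding_of p E')"
proof -
  define X where "X = {E' \<in> occurrences s p. E' \<subseteq> I}"
  have "finite X" "X \<noteq> {}" using E by (auto simp: X_def finite_occurrences)
  then obtain E' where E': "E' \<in> X" and max: "\<And>F. F \<in> X \<Longrightarrow> \<Sum>F \<le> \<Sum>E'"
  proof -
    have "Max ((\<lambda>F. \<Sum>F) ` X) \<in> (\<lambda>F. \<Sum>F) ` X"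
      using \<open>finite X\<close> \<open>X \<noteq> {}\<close> by (intro Max_in) simp_all
    then obtain E' where "E' \<in> X" "\<Sum>E' = Max ((\<lambda>F. \<Sum>F) ` X)" by force
    then show thesis using that \<open>finite X\<close> by simp
  qed
  have "E' \<subseteq> {..<length p}" using E' occurrences_subset unfolding X_def by blast
  then have fin: "finite E'" using finite_subset by blast
  have "rightmost p (embedding_of p E')"
  proof (rule rightmostI_bonds)
    fix k assume k: "k \<in> bonds p" and nz: "embedding_of p E' ! k \<noteq> 0"
    then have kl: "k < length p" "Suc k < length p" by (auto simp: bonds_def)
    have kE: "k \<in> E'" using nz kl embedding_of_nth_neq_0[OF p] by blast
    have "Suc k \<in> E'"
    proof (rule ccontr)
      assume nE: "Suc k \<notin> E'"
      \<comment> \<open>The move stays within \<open>I\<close> because \<open>Suc k\<close> is a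
        tail position. It raises the sum of positions by one, against maximality.\<close>
      have "insert (Suc k) (E' - {k}) \<in> X"
        using occurrence_move_right[of E' s p k] E' k kE nE I p
        by (auto simp: X_def permutation_def)
      then have "\<Sum>(insert (Suc k) (E' - {k})) \<le> \<Sum>E'" by (rule max)
      moreover have "\<Sum>E' = k + \<Sum>(E' - {k})" using fin kE by (rule sum.remove)
      ultimately show False using fin nE by simp
    qed
    then show "embedding_of p E' ! Suc k \<noteq> 0" using kl embedding_of_nth_neq_0[OF p] by blast
  qed
  then show thesis using that E' by (auto simp: X_def)
qed

lemma single_block_free_position:
  assumes p: "permutation p" and single: "single_block s p"
  obtains h where "h < length p" "h \<notin> Suc ` bonds p"
    "\<And>I E. E \<in> occurrences s p \<Longrightarrow> E \<subseteq> I \<Longrightarrow> Suc ` bonds p \<subseteq> I \<Longrightarrow>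
       \<exists>E'\<in>occurrences s p. E' \<subseteq> I - {h}"
proof -
  define Q where "Q i \<longleftrightarrow> i < length p \<and> (\<forall>e\<in>rightmost_embeddings s p. e ! i = 0)" for i
  define h where "h = (LEAST i. Q i)"
  have "\<exists>i. Q i" using single by (auto simp: single_block_def Q_def)
  then have Qh: "Q h" unfolding h_def by (rule LeastI_ex)
  \<comment> \<open>If \<open>h\<close> were \<open>Suc k\<close> for a bond \<open>k\<close>, a
    rightmost embedding vanishing at \<open>h\<close> would vanish at \<open>k\<close> too, and
    \<open>k\<close> would be a smaller position with the property \<open>Q\<close>.\<close>
  have "h \<notin> Suc ` bonds p"
  proof
    assume "h \<in> Suc ` bonds p"
    then obtain k where k: "h = Suc k" "k \<in> bonds p" by blast
    have "e ! k = 0" if "e \<in> rightmost_embeddings s p" for e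
      using that Qh k rightmost_bond[of p e k] by (auto simp: Q_def rightmost_embeddings_eq)
    then have "Q k" using k(2) by (simp add: Q_def bonds_def)
    then have "h \<le> k" unfolding h_def by (rule Least_le)
    then show False using k by simp
  qed
  moreover have "\<exists>E'\<in>occurrences s p. E' \<subseteq> I - {h}"
    if E: "E \<in> occurrences s p" "E \<subseteq> I" "Suc ` bonds p \<subseteq> I" for I E
  proof -
    obtain E' where E': "E' \<in> occurrences s p" "E' \<subseteq> I" "rightmost p (embedding_of p E')"
      using rightmost_occurrence_exists[OF p E] by blast
    then have "embedding_of p E' ! h = 0"
      using Qh by (auto simp: Q_def rightmost_embeddings_eq embeddings_eq_image)
    then have "h \<notin> E'" using embedding_of_nth_neq_0[OF p, of h E'] Qh by (auto simp: Q_def)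
    then show ?thesis using E' by blast
  qed
  ultimately show thesis using that Qh by (auto simp: Q_def)
qed

section \<open>The sign-reversing involution and the alternating sums\<close>

lemma sum_toggle_eq_0:
  fixes U :: "nat set set"
  assumes U: "U \<subseteq> Pow {..<n}" and h: "h < n"
    and ins: "\<And>I. I \<in> U \<Longrightarrow> insert h I \<in> U" and rem: "\<And>I. I \<in> U \<Longrightarrow> I - {h} \<in> U"
  shows "(\<Sum>I\<in>U. (-1) ^ (n - card I) :: int) = 0"
proof -
  define t where "t I = (if h \<in> I then I - {h} else insert h I)" for I
  \<comment> \<open>The set with \<open>h\<close> added still has at most \<open>n\<close> elements,
    so the truncated subtraction is exact and the exponents differ by one.\<close>
  have key: "(-1) ^ (n - card I) = - ((-1) ^ (n - card (insert h I)) :: int)"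
    if "I \<subseteq> {..<n}" "h \<notin> I" for I
  proof -
    have "finite I" using that(1) finite_subset by blast
    moreover have "card (insert h I) \<le> card {..<n}" using that h by (intro card_mono) auto
    ultimately have "n - card I = Suc (n - card (insert h I))" using that(2) by simp
    then show ?thesis by simp
  qed
  have "(-1) ^ (n - card (t I)) = - ((-1) ^ (n - card I) :: int)" if "I \<in> U" for I
  proof -
    have "I \<subseteq> {..<n}" "I - {h} \<subseteq> {..<n}" using that U by auto
    then show ?thesis using key[of "I - {h}"] key[of I] by (cases "h \<in> I") (simp_all add: t_def insert_absorb del: card_Diff_insert card_Diff_singleton)
  qed
  \<comment> \<open>Reindexing by the involution \<open>t\<close> shows that the sum equals its own
    negative.\<close>
  then have "(\<Sum>I\<in>U. (-1) ^ (n - card I) :: int) = (\<Sum>I\<in>U. - ((-1) ^ (n - card I)))"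
    using ins rem
    by (intro sum.reindex_bij_witness[of U t t]) (auto simp: t_def insert_absorb)
  then show ?thesis by (simp add: sum_negf)
qed

text \<open>The position sets on the right are grouped by the pattern they carry. Each is an
  occurrence of exactly one permutation \<open>l\<close>, the standardization of its letters, and it
  contains an occurrence of \<open>t\<close> exactly when \<open>t\<close> is a pattern in
  \<open>l\<close>.\<close>

lemma sum_NE_interval:
  assumes t: "permutation t" and p: "permutation p"
  shows "(\<Sum>l\<in>pattern_interval t p. (-1) ^ (length p - length l) * int (NE l p)) =
    (\<Sum>I | I \<subseteq> {..<length p} \<and> Suc ` bonds p \<subseteq> I \<and> (\<exists>E\<in>occurrences t p. E \<subseteq> I).
       (-1) ^ (length p - card I))"
    (is "?lhs = sum ?g ?U")
proof -
  define N where "N l = {I \<in> occurrences l p. Suc ` bonds p \<subseteq> I}" for l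
  have "sum ?g (N l) = (\<Sum>I\<in>N l. (-1) ^ (length p - length l))" for l
    by (intro sum.cong) (auto simp: N_def card_occurrence)
  then have "?lhs = (\<Sum>l\<in>pattern_interval t p. sum ?g (N l))"
    by (simp add: NE_eq_card_occurrences[OF p] mult.commute flip: N_def)
  also have "\<dots> = sum ?g (\<Union>l\<in>pattern_interval t p. N l)"
  proof (rule sum.UNION_disjoint[symmetric])
    have "l = l'" if l: "l \<in> pattern_interval t p" "l' \<in> pattern_interval t p"
      and I: "I \<in> N l" "I \<in> N l'" for l l' I
    proof -
      have "order_iso (nths p I) l" "order_iso (nths p I) l'"
        using I by (simp_all add: N_def occurrences_def)
      then have "order_iso l l'" by (rule order_iso_trans[OF order_iso_sym])
      then show ?thesis
        using l order_iso_permutation_eq by (simp add: pattern_interval_def)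
    qed
    then show "\<forall>l\<in>pattern_interval t p. \<forall>l'\<in>pattern_interval t p. l \<noteq> l' \<longrightarrow> N l \<inter> N l' = {}"
      by blast
  qed (auto simp: N_def finite_occurrences finite_pattern_interval)
  also have "(\<Union>l\<in>pattern_interval t p. N l) = ?U"
  proof (intro equalityI subsetI)
    fix I assume "I \<in> (\<Union>l\<in>pattern_interval t p. N l)"
    then obtain l where l: "pattern_le t l" "I \<in> occurrences l p" "Suc ` bonds p \<subseteq> I"
      by (auto simp: N_def pattern_interval_def)
    then show "I \<in> ?U"
      using pattern_le_iff_occurrence_subset[OF l(2), of t] occurrences_subset[OF l(2)] by simp
  next
    fix I assume I: "I \<in> ?U"
    then obtain E where E: "E \<in> occurrences t p" "E \<subseteq> I" by blast
    have "finite I" using I finite_subset by blast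
    then have "card E \<le> card I" using E(2) by (rule card_mono)
    \<comment> \<open>Since \<open>t\<close> is nonempty, so is the sublist at \<open>I\<close>; the
      empty list could not be standardized to a permutation.\<close>
    moreover have "card E > 0" using card_occurrence[OF E(1)] t by (simp add: permutation_def)
    moreover have "length (nths p I) = card I"
    proof -
      have "{i. i < length p \<and> i \<in> I} = I" using I by auto
      then show ?thesis by (simp add: length_nths)
    qed
    ultimately have "nths p I \<noteq> []" by force
    then obtain l where l: "permutation l" "order_iso (nths p I) l"
      using order_iso_permutation_exists p by (metis distinct_nthsI permutation_def)
    then have occ: "I \<in> occurrences l p" using I by (simp add: occurrences_def)
    then have "pattern_le t l" using pattern_le_iff_occurrence_subset E by blast
    moreover have "pattern_le l p" using occ by (auto simp: pattern_le_def)
    ultimately have "l \<in> pattern_interval t p" using l(1) by (simp add: pattern_interval_def)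
    moreover have "I \<in> N l" using I occ by (simp add: N_def)
    ultimately show "I \<in> (\<Union>l\<in>pattern_interval t p. N l)" by blast
  qed
  finally show ?thesis .
qed

lemma sum_NE_self:
  assumes "permutation p"
  shows "(\<Sum>l\<in>pattern_interval p p. (-1) ^ (length p - length l) * int (NE l p)) = 1"
proof -
  \<comment> \<open>An occurrence of \<open>p\<close> in itself has as many positions as
    \<open>p\<close>, hence uses all of them.\<close>
  have full: "I = {..<length p}" if "I \<in> occurrences p p" for I
    using card_occurrence[OF that] occurrences_subset[OF that]
    by (intro card_subset_eq) simp_all
  have "{..<length p} \<in> occurrences p p" by (simp add: occurrences_def order_iso_refl)
  moreover have "Suc ` bonds p \<subseteq> {..<length p}" by (auto simp: bonds_def)
  ultimately have "{I \<in> occurrences p p. Suc ` bonds p \<subseteq> I} = {{..<length p}}"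
    using full by blast
  then have "NE p p = 1" using NE_eq_card_occurrences[OF assms] by simp
  then show ?thesis using assms by (simp add: pattern_interval_self)
qed

lemma sum_NE_single_block:
  assumes "permutation t" "permutation p" "single_block t p"
  shows "(\<Sum>l\<in>pattern_interval t p. (-1) ^ (length p - length l) * int (NE l p)) = 0"
proof -
  obtain h where "h < length p" "h \<notin> Suc ` bonds p"
    "\<And>I E. E \<in> occurrences t p \<Longrightarrow> E \<subseteq> I \<Longrightarrow> Suc ` bonds p \<subseteq> I \<Longrightarrow>
       \<exists>E'\<in>occurrences t p. E' \<subseteq> I - {h}"
    by (rule single_block_free_position[OF assms(2,3)]) blast
  then show ?thesis
    unfolding sum_NE_interval[OF assms(1,2)]
    \<comment> \<open>Adding \<open>h\<close> keeps both containments. Removing \<open>h\<close>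
      keeps the tails, as \<open>h\<close> is in none, and keeps some occurrence of
      \<open>t\<close>, by the last property of \<open>h\<close>.\<close>
    by (intro sum_toggle_eq_0[of _ _ h]) auto
qed

theorem proposition27:
  fixes \<sigma> \<pi> :: "nat list"
  assumes "permutation \<sigma>" and "permutation \<pi>"
    and "pattern_le \<sigma> \<pi>"
    and "single_interval \<sigma> \<pi>"
  shows "mobius \<sigma> \<pi> = (-1) ^ (length \<pi> - length \<sigma>) * int (NE \<sigma> \<pi>)"
proof (rule mobius_eqI[OF assms(1-3)])
  fix \<tau> assume \<tau>: "\<tau> \<in> pattern_interval \<sigma> \<pi>"
  show "(\<Sum>l\<in>pattern_interval \<tau> \<pi>. (-1) ^ (length \<pi> - length l) * int (NE l \<pi>)) =
      (if \<tau> = \<pi> then 1 else 0)"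
  proof (cases "\<tau> = \<pi>")
    case True
    then show ?thesis using sum_NE_self[OF assms(2)] by simp
  next
    case False
    then have "\<tau> \<in> half_open_interval \<sigma> \<pi>"
      using \<tau> by (simp add: pattern_interval_def half_open_interval_def pattern_less_def)
    then have "permutation \<tau>" "single_block \<tau> \<pi>"
      using assms(4) by (auto simp: single_interval_def half_open_interval_def)
    then show ?thesis using sum_NE_single_block[OF _ assms(2)] False by simp
  qed
qed

end
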